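(* Let $\Gamma=\Gamma_{D^-}$ be the coset graph of the additive code $D^-$ defined in the context, and let $\Gamma_2$ be the graph on the same vertex set in which two vertices are adjacent iff they are at distance $2$ in $\Gamma$. Then $\Gamma_2$ is strongly regular with parameters $(2^{10},495,238,240)$.
   Context: $\mathbb{F}_4=\{0,1,\omega,\omega^2\}$ with $\omega^2=\omega+1$. The coset graph $\Gamma_C$ of an additive code $C\subseteq\mathbb{F}_4^n$ (additive subgroup) has as vertices the cosets $x+C$, two cosets adjacent if their difference contains a vector of Hamming weight $1$. Strongly regular parameters $(\nu,\kappa,\lambda,\mu)$: number of vertices, degree, common neighbours of adjacent pairs, common neighbours of non-adjacent pairs. $D^-$ is the $\mathbb{F}_2$-span of the following $12$ vectors of $\mathbb{F}_4^{11}$: $(0,0,0,0,0,\omega^2,\omega^2,0,\omega,1,\omega)$, $(0,0,0,0,0,\omega,0,\omega,\omega,\omega,1)$, $(1,0,0,0,0,1,0,1,\omega^2,\omega^2,1)$, $(\omega,0,0,0,0,0,\omega,1,\omega,\omega,\omega)$, $(0,1,0,0,0,0,1,1,1,\omega^2,\omega^2)$, $(0,\omega,0,0,0,\omega^2,1,\omega^2,\omega,\omega,0)$, $(0,0,1,0,0,\omega,\omega,1,1,0,1)$, $(0,0,\omega,0,0,\omega,1,\omega,\omega^2,\omega^2,0)$, $(0,0,0,1,0,\omega,\omega,\omega,0,1,\omega)$, $(0,0,0,\omega,0,\omega^2,1,1,\omega^2,0,\omega)$, $(0,0,0,0,1,\omega^2,\omega^2,\omega^2,1,0,\omega^2)$,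 $(0,0,0,0,\omega,\omega,1,0,1,\omega,\omega)$. *)

theory Defs
  imports
    "HOL-Analysis.Analysis"
    "HOL-Library.Z2"
    "Graph_Theory.Graph_Theory"
begin

section \<open>The field with four elements\<close>

datatype gf4 = GF4_0 | GF4_1 | GF4_omega (\<open>\<omega>\<close>) | GF4_omega_sq

instantiation gf4 :: field
begin

definition zero_gf4 :: gf4 where "0 = GF4_0"

definition one_gf4 :: gf4 where "1 = GF4_1"

definition uminus_gf4 :: "gf4 \<Rightarrow> gf4" where "- x = (x :: gf4)"

fun plus_gf4 :: "gf4 \<Rightarrow> gf4 \<Rightarrow> gf4" where
  "GF4_0 + y = y"
| "x + GF4_0 = x"
| "GF4_1 + GF4_1 = GF4_0"
| "GF4_1 + GF4_omega = GF4_omega_sq"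
| "GF4_1 + GF4_omega_sq = GF4_omega"
| "GF4_omega + GF4_1 = GF4_omega_sq"
| "GF4_omega + GF4_omega = GF4_0"
| "GF4_omega + GF4_omega_sq = GF4_1"
| "GF4_omega_sq + GF4_1 = GF4_omega"
| "GF4_omega_sq + GF4_omega = GF4_1"
| "GF4_omega_sq + GF4_omega_sq = GF4_0"

definition minus_gf4 :: "gf4 \<Rightarrow> gf4 \<Rightarrow> gf4" where "x - y = x + (y :: gf4)"

fun times_gf4 :: "gf4 \<Rightarrow> gf4 \<Rightarrow> gf4" where
  "GF4_0 * y = GF4_0"
| "x * GF4_0 = GF4_0"
| "GF4_1 * y = y"
| "x * GF4_1 = x"
| "GF4_omega * GF4_omega = GF4_omega_sq"
| "GF4_omega * GF4_omega_sq = GF4_1"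
| "GF4_omega_sq * GF4_omega = GF4_1"
| "GF4_omega_sq * GF4_omega_sq = GF4_omega"

fun inverse_gf4 :: "gf4 \<Rightarrow> gf4" where
  "inverse GF4_0 = GF4_0"
| "inverse GF4_1 = GF4_1"
| "inverse GF4_omega = GF4_omega_sq"
| "inverse GF4_omega_sq = GF4_omega"

definition divide_gf4 :: "gf4 \<Rightarrow> gf4 \<Rightarrow> gf4" where "x div y = x * inverse (y :: gf4)"

instance
proof
  fix a b c :: gf4
  show "a + b + c = a + (b + c)" by (cases a; cases b; cases c) simp_all
  show "a + b = b + a" by (cases a; cases b) simp_all
  show "0 + a = a" by (simp add: zero_gf4_def)
  show "- a + a = 0" by (cases a) (simp_all add: zero_gf4_def uminus_gf4_def)
  show "a - b = a + - b" by (simp add: minus_gf4_def uminus_gf4_def)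
  show "a * b * c = a * (b * c)" by (cases a; cases b; cases c) simp_all
  show "a * b = b * a" by (cases a; cases b) simp_all
  show "1 * a = a" by (cases a) (simp_all add: one_gf4_def)
  show "(a + b) * c = a * c + b * c" by (cases a; cases b; cases c) simp_all
  show "(0 :: gf4) \<noteq> 1" by (simp add: zero_gf4_def one_gf4_def)
  show "a \<noteq> 0 \<Longrightarrow> inverse a * a = 1" by (cases a) (simp_all add: zero_gf4_def one_gf4_def)
  show "a div b = a * inverse b" by (simp add: divide_gf4_def)
  show "inverse (0 :: gf4) = 0" by (simp add: zero_gf4_def)
qed

end

lemma UNIV_gf4: "(UNIV :: gf4 set) = {0, 1, \<omega>, \<omega>\<^sup>2}"
proof -
  have "x \<in> {0, 1, \<omega>, \<omega>\<^sup>2}" for x :: gf4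
    by (cases x) (simp_all add: zero_gf4_def one_gf4_def power2_eq_square)
  then show ?thesis by blast
qed

instance gf4 :: finite
  by standard (simp add: UNIV_gf4)

lemma omega_squared: "\<omega>\<^sup>2 = \<omega> + 1"
  by (simp add: power2_eq_square one_gf4_def)

lemma gf4_add_self: "x + x = (0 :: gf4)"
  by (cases x) (simp_all add: zero_gf4_def)


section \<open>Additive codes and coset graphs\<close>

definition gf4_of_bit :: "bit \<Rightarrow> gf4" where
  "gf4_of_bit c = (if c = 0 then 0 else 1)"

definition scaleF2 :: "bit \<Rightarrow> gf4 ^ 'n \<Rightarrow> gf4 ^ 'n" where
  "scaleF2 c x = gf4_of_bit c *s x"

global_interpretation F2: vector_space "scaleF2 :: bit \<Rightarrow> gf4 ^ 'n \<Rightarrow> gf4 ^ 'n"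
proof
  fix a b :: bit and x y :: "gf4 ^ 'n"
  have add: "gf4_of_bit (a + b) = gf4_of_bit a + gf4_of_bit b"
    by (cases a; cases b) (simp_all add: gf4_of_bit_def gf4_add_self)
  have mult: "gf4_of_bit (a * b) = gf4_of_bit a * gf4_of_bit b"
    by (cases a; cases b) (simp_all add: gf4_of_bit_def)
  show "scaleF2 a (x + y) = scaleF2 a x + scaleF2 a y"
    by (simp add: scaleF2_def vector_add_ldistrib)
  show "scaleF2 (a + b) x = scaleF2 a x + scaleF2 b x"
    unfolding scaleF2_def add by (rule vector_sadd_rdistrib)
  show "scaleF2 a (scaleF2 b x) = scaleF2 (a * b) x"
    unfolding scaleF2_def mult by (rule vector_smult_assoc)
  show "scaleF2 1 x = x"
    by (simp add: scaleF2_def gf4_of_bit_def)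
qed

definition hamming_weight :: "gf4 ^ 'n \<Rightarrow> nat" where
  "hamming_weight x = card {i. x $ i \<noteq> 0}"

definition coset_graph :: "(gf4 ^ 'n) set \<Rightarrow> (gf4 ^ 'n) set pair_pre_digraph" where
  "coset_graph C =
    (let V = range (\<lambda>x. (+) x ` C) in
     \<lparr> pverts = V,
       parcs = {(A, B). A \<in> V \<and> B \<in> V \<and> A \<noteq> B \<and>
                  (\<exists>a\<in>A. \<exists>b\<in>B. hamming_weight (a - b) = 1)} \<rparr>)"


section \<open>Distance graphs and strongly regular graphs\<close>

text \<open>The graph distance is the infimum \<^const>\<open>wf_digraph.\<mu>\<close> of the costs of all walks, where
  every arc has cost 1.\<close>

definition distance_graph :: "nat \<Rightarrow> 'a pair_pre_digraph \<Rightarrow> 'a pair_pre_digraph" where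
  "distance_graph k G =
    \<lparr> pverts = pverts G,
      parcs = {(u, v). u \<in> pverts G \<and> v \<in> pverts G \<and>
                 wf_digraph.\<mu> (with_proj G) (\<lambda>_. 1) u v = ereal (real k)} \<rparr>"

definition strongly_regular :: "'a pair_pre_digraph \<Rightarrow> nat \<Rightarrow> nat \<Rightarrow> nat \<Rightarrow> nat \<Rightarrow> bool" where
  "strongly_regular G \<nu> \<kappa> l m \<longleftrightarrow>
    pair_graph G \<and>
    card (pverts G) = \<nu> \<and>
    (\<forall>x\<in>pverts G. out_degree (with_proj G) x = \<kappa>) \<and>
    (\<forall>x\<in>pverts G. \<forall>y\<in>pverts G. (x, y) \<in> parcs G \<longrightarrow>
       card {z. (x, z) \<in> parcs G \<and> (y, z) \<in> parcs G} = l) \<and>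
    (\<forall>x\<in>pverts G. \<forall>y\<in>pverts G. x \<noteq> y \<and> (x, y) \<notin> parcs G \<longrightarrow>
       card {z. (x, z) \<in> parcs G \<and> (y, z) \<in> parcs G} = m)"


section \<open>The code \<open>D\<^sup>-\<close>\<close>

definition D_minus :: "(gf4 ^ 11) set" where
  "D_minus = F2.span {
     vector [0, 0, 0, 0, 0, \<omega>\<^sup>2, \<omega>\<^sup>2, 0, \<omega>, 1, \<omega>],
     vector [0, 0, 0, 0, 0, \<omega>, 0, \<omega>, \<omega>, \<omega>, 1],
     vector [1, 0, 0, 0, 0, 1, 0, 1, \<omega>\<^sup>2, \<omega>\<^sup>2, 1],
     vector [\<omega>, 0, 0, 0, 0, 0, \<omega>, 1, \<omega>, \<omega>, \<omega>],
     vector [0, 1, 0, 0, 0, 0, 1, 1, 1, \<omega>\<^sup>2, \<omega>\<^sup>2],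
     vector [0, \<omega>, 0, 0, 0, \<omega>\<^sup>2, 1, \<omega>\<^sup>2, \<omega>, \<omega>, 0],
     vector [0, 0, 1, 0, 0, \<omega>, \<omega>, 1, 1, 0, 1],
     vector [0, 0, \<omega>, 0, 0, \<omega>, 1, \<omega>, \<omega>\<^sup>2, \<omega>\<^sup>2, 0],
     vector [0, 0, 0, 1, 0, \<omega>, \<omega>, \<omega>, 0, 1, \<omega>],
     vector [0, 0, 0, \<omega>, 0, \<omega>\<^sup>2, 1, 1, \<omega>\<^sup>2, 0, \<omega>],
     vector [0, 0, 0, 0, 1, \<omega>\<^sup>2, \<omega>\<^sup>2, \<omega>\<^sup>2, 1, 0, \<omega>\<^sup>2],
     vector [0, 0, 0, 0, \<omega>, \<omega>, 1, 0, 1, \<omega>, \<omega>]}"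

end

theory Submission
  imports Defs
begin

text \<open>
  The first six coordinates form an information set of \<open>D\<^sup>-\<close>, so the code is the kernel of an
  additive surjection onto the 5-tuples over the field with four elements, and its coset graph is
  the Cayley graph of this elementary abelian group of order 1024 whose connection set \<open>S1\<close>
  consists of the 33 syndromes of weight-1 vectors.
  All nonzero words of the dual code have weight \<open>w\<close> in \<open>{6, 8, 10}\<close>, so the nontrivial
  eigenvalues \<open>\<theta> = 33 - 4 w\<close> are \<open>9\<close>, \<open>1\<close>, \<open>- 7\<close>. The sums of two syndromes from different
  coordinates, counted with order, have Fourier transform \<open>\<theta>\<^sup>2 - 2 \<theta> - 33\<close>, which is \<open>30\<close> or \<open>- 34\<close>
  off the trivial character. Hence the convolution square of their multiplicity function
  \<open>count2\<close> is a combination of \<open>count2\<close>, the unit and a constant. Its value at 0 forces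
  \<open>count2\<close> to be twice the indicator of a set, its other values are the parameters of the
  strongly regular graph, and the convolution with the multiplicity function of \<open>S1\<close> shows that
  this set is disjoint from \<open>S1\<close>, i.e. consists of the syndromes at distance 2 from 0.
\<close>

section \<open>Fourier analysis on elementary abelian 2-groups\<close>

text \<open>\<open>\<psi>\<close> identifies the group with its own dual, so transforms live on the
  same type. Exponent 2 makes all characters signs, hence the codomain \<open>int\<close>;
  \<open>sum_eq\<close> encodes nondegeneracy.\<close>

locale bicharacter =
  fixes \<psi> :: "'v :: {finite, ab_group_add} \<Rightarrow> 'v \<Rightarrow> int"
  assumes add: "\<psi> c (x + y) = \<psi> c x * \<psi> c y"
    and sym: "\<psi> c x = \<psi> x c"
    and zero: "\<psi> c 0 = 1"
    and sum_eq: "(\<Sum>c\<in>UNIV. \<psi> c x) = (if x = 0 then int CARD('v) else 0)"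
    and add_self: "x + x = (0 :: 'v)"
begin

lemma zero_left [simp]: "\<psi> 0 x = 1"
  by (subst sym) (rule zero)

lemma square [simp]: "\<psi> c x * \<psi> c x = 1"
  by (simp flip: add add: add_self zero)

lemma add_cancel [simp]: "x + (x + y) = (y :: 'v)"
  by (metis add_self add.assoc add_0)

lemma add_eq_0_iff_eq: "x + y = 0 \<longleftrightarrow> x = (y :: 'v)"
  by (metis add_cancel add_self add.right_neutral)

lemma minus_eq_add: "x - y = x + (y :: 'v)"
  by (metis add_self add.inverse_unique diff_conv_add_uminus)

section \<open>Fourier transform and convolution\<close>

definition fourier :: "('v \<Rightarrow> int) \<Rightarrow> 'v \<Rightarrow> int" where
  "fourier u c = (\<Sum>d\<in>UNIV. u d * \<psi> c d)"

text \<open>The usual convolution, as every element is its own inverse.\<close>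

definition conv :: "('v \<Rightarrow> int) \<Rightarrow> ('v \<Rightarrow> int) \<Rightarrow> 'v \<Rightarrow> int" where
  "conv u v d = (\<Sum>e\<in>UNIV. u e * v (e + d))"

lemma sum_translate: "(\<Sum>d\<in>UNIV. w (e + d)) = (\<Sum>d\<in>UNIV. w (d :: 'v) :: int)"
  by (rule sum.reindex_bij_witness[where i = "(+) e" and j = "(+) e"]) auto

lemma fourier_conv: "fourier (conv u v) c = fourier u c * fourier v c"
proof -
  have "fourier (conv u v) c = (\<Sum>d\<in>UNIV. \<Sum>e\<in>UNIV. u e * v (e + d) * \<psi> c d)"
    by (simp add: fourier_def conv_def sum_distrib_right)
  also have "\<dots> = (\<Sum>e\<in>UNIV. \<Sum>d\<in>UNIV. u e * v (e + d) * \<psi> c d)"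
    by (rule sum.swap)
  also have "\<dots> = (\<Sum>e\<in>UNIV. \<Sum>d\<in>UNIV. u e * v d * \<psi> c (e + d))"
  proof (rule sum.cong[OF refl])
    fix e
    show "(\<Sum>d\<in>UNIV. u e * v (e + d) * \<psi> c d) = (\<Sum>d\<in>UNIV. u e * v d * \<psi> c (e + d))"
      using sum_translate[of "\<lambda>d. u e * v d * \<psi> c (e + d)" e] by simp
  qed
  also have "\<dots> = fourier u c * fourier v c"
    by (simp add: fourier_def sum_product add mult_ac)
  finally show ?thesis .
qed

lemma fourier_inversion: "(\<Sum>c\<in>UNIV. fourier u c * \<psi> c x) = int CARD('v) * u x"
proof -
  have "(\<Sum>c\<in>UNIV. fourier u c * \<psi> c x) = (\<Sum>c\<in>UNIV. \<Sum>d\<in>UNIV. u d * \<psi> c (d + x))"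
    by (simp add: fourier_def sum_distrib_right add mult.assoc)
  also have "\<dots> = (\<Sum>d\<in>UNIV. u d * (\<Sum>c\<in>UNIV. \<psi> c (d + x)))"
    by (subst sum.swap) (simp add: sum_distrib_left)
  also have "\<dots> = (\<Sum>d\<in>UNIV. if d = x then u d * int CARD('v) else 0)"
    by (rule sum.cong) (auto simp: sum_eq add_eq_0_iff_eq)
  also have "\<dots> = int CARD('v) * u x"
    by simp
  finally show ?thesis .
qed

text \<open>Reduces an identity between functions on the group to a scalar identity at each
  character.\<close>

lemma fourier_inject:
  assumes "\<And>c. fourier u c = fourier v c"
  shows "u x = v x"
proof -
  have "int CARD('v) * u x = int CARD('v) * v x"
    by (simp flip: fourier_inversion add: assms)
  then show ?thesis by simp
qed

lemma fourier_add: "fourier (\<lambda>d. u d + v d) c = fourier u c + fourier v c"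
  by (simp add: fourier_def distrib_right sum.distrib)

lemma fourier_scale: "fourier (\<lambda>d. k * u d) c = k * fourier u c"
  by (simp add: fourier_def sum_distrib_left mult.assoc)

lemma fourier_delta: "fourier (\<lambda>d. if d = 0 then k else 0) c = k"
proof -
  have "fourier (\<lambda>d. if d = 0 then k else 0) c = (\<Sum>d\<in>UNIV. if d = 0 then k * \<psi> c d else 0)"
    unfolding fourier_def by (rule sum.cong) auto
  then show ?thesis by (simp add: zero)
qed

lemma fourier_const: "fourier (\<lambda>d. k) c = (if c = 0 then k * int CARD('v) else 0)"
proof -
  have "(\<Sum>d\<in>UNIV. \<psi> c d) = (if c = 0 then int CARD('v) else 0)"
    by (simp only: sym[of c] sum_eq)
  then show ?thesis
    by (simp add: fourier_def flip: sum_distrib_left)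
qed

lemma fourier_at_0: "fourier u 0 = (\<Sum>d\<in>UNIV. u d)"
  by (simp add: fourier_def)

lemma fourier_card_fibre:
  assumes "finite Q"
  shows "fourier (\<lambda>d. int (card {q \<in> Q. val q = d})) c = (\<Sum>q\<in>Q. \<psi> c (val q))"
proof -
  have "(\<Sum>q\<in>Q. \<psi> c (val q)) = (\<Sum>d\<in>UNIV. \<Sum>q\<in>{q \<in> Q. val q = d}. \<psi> c (val q))"
    using assms by (intro sum.group[symmetric]) auto
  also have "\<dots> = (\<Sum>d\<in>UNIV. int (card {q \<in> Q. val q = d}) * \<psi> c d)"
    by (rule sum.cong) auto
  finally show ?thesis by (simp add: fourier_def)
qed

end

text \<open>Orthogonality factors over the components; iteration builds the pairing on 5-tuples from
  one on a single entry.\<close>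

lemma bicharacter_prod:
  assumes "bicharacter \<psi>" "bicharacter \<xi>"
  shows "bicharacter (\<lambda>c x. \<psi> (fst c) (fst x) * \<xi> (snd c) (snd x))"
proof -
  interpret a: bicharacter \<psi> by fact
  interpret b: bicharacter \<xi> by fact
  show ?thesis
  proof
    fix c x y :: "'a \<times> 'b"
    show "\<psi> (fst c) (fst (x + y)) * \<xi> (snd c) (snd (x + y)) =
      \<psi> (fst c) (fst x) * \<xi> (snd c) (snd x) * (\<psi> (fst c) (fst y) * \<xi> (snd c) (snd y))"
      by (simp add: a.add b.add mult_ac)
    show "\<psi> (fst c) (fst x) * \<xi> (snd c) (snd x) = \<psi> (fst x) (fst c) * \<xi> (snd x) (snd c)"
      by (metis a.sym b.sym)
    show "\<psi> (fst c) (fst 0) * \<xi> (snd c) (snd 0) = 1"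
      by (simp add: a.zero b.zero)
    have "(\<Sum>c\<in>UNIV. \<psi> (fst c) (fst x) * \<xi> (snd c) (snd x))
        = (\<Sum>c\<in>UNIV. \<psi> c (fst x)) * (\<Sum>c\<in>UNIV. \<xi> c (snd x))"
      by (simp add: sum_product sum.cartesian_product flip: UNIV_Times_UNIV)
        (simp add: case_prod_beta)
    then show "(\<Sum>c\<in>UNIV. \<psi> (fst c) (fst x) * \<xi> (snd c) (snd x)) =
        (if x = 0 then int CARD('a \<times> 'b) else 0)"
      by (simp add: a.sum_eq b.sum_eq prod_eq_iff)
    show "x + x = 0"
      by (simp add: prod_eq_iff a.add_self b.add_self)
  qed
qed

section \<open>Codes whose dual has weights 6, 8 and 10\<close>

lemma gf4_distinct [simp]: "\<omega> \<noteq> 0" "\<omega> \<noteq> 1" "1 \<noteq> \<omega>" "\<omega> + 1 \<noteq> 0"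
  by (simp_all add: zero_gf4_def one_gf4_def)

lemma gf4_nonzero: "- {0 :: gf4} = {1, \<omega>, \<omega> + 1}"
  unfolding Compl_eq_Diff_UNIV UNIV_gf4 omega_squared by (auto simp: zero_gf4_def one_gf4_def)

text \<open>\<open>col i a\<close> stands for the syndrome of the vector with single entry
  \<open>a\<close> in coordinate \<open>i\<close>. A character sums to 3 over a coordinate where it
  is trivial and to -1 otherwise, so a dual word of weight w gives 33 - 4 w.\<close>

locale dual_weights_6_8_10 = bicharacter \<psi>
  for \<psi> :: "'v :: {finite, ab_group_add} \<Rightarrow> 'v \<Rightarrow> int" +
  fixes col :: "'n :: finite \<Rightarrow> gf4 \<Rightarrow> 'v"
  assumes col_add: "col i (a + b) = col i a + col i b"
    and col_nonzero: "a \<noteq> 0 \<Longrightarrow> col i a \<noteq> 0"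
    and card_index: "CARD('n) = 11"
    and card_group: "CARD('v) = 1024"
    and eigenvalue:
      "c \<noteq> 0 \<Longrightarrow> (\<Sum>i\<in>UNIV. \<Sum>a\<in>- {0}. \<psi> c (col i a)) \<in> {9, 1, - 7}"
begin

section \<open>Multiplicities of syndromes and of their pairwise sums\<close>

definition line_sum :: "'v \<Rightarrow> 'n \<Rightarrow> int" where
  "line_sum c i = (\<Sum>a\<in>- {0}. \<psi> c (col i a))"

definition \<theta> :: "'v \<Rightarrow> int" where
  "\<theta> c = (\<Sum>i\<in>UNIV. line_sum c i)"

definition units :: "('n \<times> gf4) set" where
  "units = UNIV \<times> - {0}"

definition pairs :: "(('n \<times> gf4) \<times> ('n \<times> gf4)) set" where
  "pairs = {(p, q) \<in> units \<times> units. fst p \<noteq> fst q}"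

definition col1 :: "'n \<times> gf4 \<Rightarrow> 'v" where
  "col1 p = col (fst p) (snd p)"

definition col2 :: "('n \<times> gf4) \<times> ('n \<times> gf4) \<Rightarrow> 'v" where
  "col2 r = col1 (fst r) + col1 (snd r)"

definition count1 :: "'v \<Rightarrow> int" where
  "count1 d = int (card {p \<in> units. col1 p = d})"

definition count2 :: "'v \<Rightarrow> int" where
  "count2 d = int (card {r \<in> pairs. col2 r = d})"

text \<open>Adding the term 1 at \<open>a = 0\<close> gives a character sum L over a group of order
  4, and L * L = 4 * L.\<close>

lemma line_sum_square: "line_sum c i * line_sum c i = 3 + 2 * line_sum c i"
proof -
  define x y where "x = \<psi> c (col i 1)" and "y = \<psi> c (col i \<omega>)"
  have [simp]: "x * x = 1" "y * y = 1" by (simp_all add: x_def y_def)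
  have [simp]: "x * (x * z) = z" "y * (y * z) = z" for z
    by (simp_all flip: mult.assoc)
  have "line_sum c i = x + y + x * y"
    unfolding line_sum_def gf4_nonzero
    by (simp add: x_def y_def col_add add mult_ac)
  then show ?thesis by (simp add: algebra_simps)
qed

lemma fourier_count1: "fourier count1 c = \<theta> c"
  unfolding count1_def
  by (subst fourier_card_fibre)
    (simp_all add: units_def col1_def \<theta>_def line_sum_def sum.cartesian_product case_prod_beta)

text \<open>All ordered pairs contribute the square of \<open>\<theta> c\<close>; the excluded pairs
  from a common coordinate contribute the squared line sums, which \<open>line_sum_square\<close>
  makes linear.\<close>

lemma fourier_count2: "fourier count2 c = \<theta> c * \<theta> c - 2 * \<theta> c - 33"
proof -
  let ?w = "\<lambda>p. \<psi> c (col1 p)"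
  have units_sum: "(\<Sum>p\<in>units. h p) = (\<Sum>i\<in>UNIV. \<Sum>a\<in>- {0}. h (i, a))"
    for h :: "'n \<times> gf4 \<Rightarrow> int"
    by (simp add: units_def sum.cartesian_product case_prod_beta)
  have \<theta>: "\<theta> c = (\<Sum>p\<in>units. ?w p)"
    by (simp add: units_sum \<theta>_def line_sum_def col1_def)
  have "fourier count2 c = (\<Sum>r\<in>pairs. ?w (fst r) * ?w (snd r))"
    unfolding count2_def by (subst fourier_card_fibre) (simp_all add: col2_def add)
  also have "\<dots> = (\<Sum>r\<in>units \<times> units.
      if fst (fst r) \<noteq> fst (snd r) then ?w (fst r) * ?w (snd r) else 0)"
    unfolding pairs_def by (rule sum.mono_neutral_cong_left) auto
  also have "\<dots> = (\<Sum>r\<in>units \<times> units. ?w (fst r) * ?w (snd r))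
      - (\<Sum>r\<in>units \<times> units. if fst (fst r) = fst (snd r) then ?w (fst r) * ?w (snd r) else 0)"
    by (subst sum_subtractf[symmetric], rule sum.cong) auto
  also have "(\<Sum>r\<in>units \<times> units. ?w (fst r) * ?w (snd r)) = \<theta> c * \<theta> c"
    by (simp add: \<theta> sum_product sum.cartesian_product case_prod_beta)
  also have "(\<Sum>r\<in>units \<times> units. if fst (fst r) = fst (snd r) then ?w (fst r) * ?w (snd r) else 0)
      = (\<Sum>p\<in>units. \<Sum>q\<in>units. if fst p = fst q then ?w p * ?w q else 0)"
    by (simp add: sum.cartesian_product case_prod_beta)
  also have "\<dots> = (\<Sum>p\<in>units. ?w p * line_sum c (fst p))"
  proof (rule sum.cong[OF refl])
    fix p
    have "(\<Sum>q\<in>units. if fst p = fst q then ?w p * ?w q else 0)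
        = (\<Sum>i\<in>UNIV. if fst p = i then ?w p * line_sum c i else 0)"
      unfolding units_sum by (rule sum.cong) (auto simp: line_sum_def sum_distrib_left col1_def)
    then show "(\<Sum>q\<in>units. if fst p = fst q then ?w p * ?w q else 0) = ?w p * line_sum c (fst p)"
      by simp
  qed
  also have "\<dots> = (\<Sum>i\<in>UNIV. line_sum c i * line_sum c i)"
    by (simp add: units_sum col1_def line_sum_def sum_distrib_right)
  also have "\<dots> = 33 + 2 * \<theta> c"
    by (simp add: line_sum_square sum.distrib card_index \<theta>_def sum_distrib_left)
  finally show ?thesis by simp
qed

lemma \<theta>_0: "\<theta> 0 = 33"
  by (simp add: \<theta>_def line_sum_def card_index gf4_nonzero)

lemma \<theta>_values: "c \<noteq> 0 \<Longrightarrow> \<theta> c \<in> {9, 1, - 7}"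
  using eigenvalue[of c] by (simp add: \<theta>_def line_sum_def)

text \<open>Off the trivial character the transform t of \<open>count2\<close> is 30 or -34, the
  roots of t^2 = 1020 - 4 t. At the trivial one t = 990, and the defect 990^2 + 4 * 990 - 1020 = 960
  * 1024 yields the constant 960.\<close>

lemma conv_count2_count2:
  "conv count2 count2 x = 960 + (if x = 0 then 1020 else 0) + (- 4) * count2 x"
proof (rule fourier_inject)
  fix c
  show "fourier (conv count2 count2) c =
      fourier (\<lambda>x. 960 + (if x = 0 then 1020 else 0) + (- 4) * count2 x) c"
    unfolding fourier_add fourier_scale fourier_delta fourier_const
      fourier_conv fourier_count2 card_group
    using \<theta>_values[of c] by (cases "c = 0") (auto simp: \<theta>_0)
qed

text \<open>The transform t of \<open>count2\<close> satisfies t - 30 = (\<theta> - 9) (\<theta> +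
  7), so (\<theta> - 1) (t - 30) = 0 off the trivial character; the constant 30 corrects the value
  there.\<close>

lemma conv_count1_count2:
  "conv count1 count2 x = 30 + (if x = 0 then - 30 else 0) + 30 * count1 x + count2 x"
proof (rule fourier_inject)
  fix c
  show "fourier (conv count1 count2) c =
      fourier (\<lambda>x. 30 + (if x = 0 then - 30 else 0) + 30 * count1 x + count2 x) c"
    unfolding fourier_add fourier_scale fourier_delta fourier_const
      fourier_conv fourier_count2 fourier_count1 card_group
    using \<theta>_values[of c] by (cases "c = 0") (auto simp: \<theta>_0)
qed

text \<open>Swapping the entries of a pair keeps its sum and has no fixed point, as the coordinates
  differ.\<close>

lemma count2_eq_0_or_ge_2: "count2 d = 0 \<or> count2 d \<ge> 2"
proof (cases "{r \<in> pairs. col2 r = d} = {}")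
  case True
  then show ?thesis unfolding count2_def by (simp only: card.empty) simp
next
  case False
  then obtain p q where pq: "(p, q) \<in> pairs" "col2 (p, q) = d" by auto
  then have "{(p, q), (q, p)} \<subseteq> {r \<in> pairs. col2 r = d}"
    by (auto simp: pairs_def col2_def add.commute)
  then have "card {(p, q), (q, p)} \<le> card {r \<in> pairs. col2 r = d}"
    by (intro card_mono) auto
  moreover have "card {(p, q), (q, p)} = 2"
  proof -
    have "p \<noteq> q" using pq by (auto simp: pairs_def)
    then show ?thesis by simp
  qed
  ultimately show ?thesis by (simp add: count2_def)
qed

lemma count2_nonneg: "count2 d \<ge> 0" by (simp add: count2_def)

lemma count1_nonneg: "count1 d \<ge> 0" by (simp add: count1_def)

text \<open>Summing \<open>count2 d * (count2 d - 2)\<close>, whose terms are nonnegative, gives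
  \<open>- 4 * count2 0\<close>: so all terms vanish.\<close>

lemma
  shows count2_values: "count2 d = 0 \<or> count2 d = 2" and count2_0: "count2 0 = 0"
proof -
  have "(\<Sum>d\<in>UNIV. count2 d) = 990"
    using fourier_at_0[of count2] by (simp add: fourier_count2 \<theta>_0)
  moreover have "(\<Sum>d\<in>UNIV. count2 d * count2 d) = 1980 - 4 * count2 0"
    using conv_count2_count2[of 0] by (simp add: conv_def)
  ultimately have *: "(\<Sum>d\<in>UNIV. count2 d * (count2 d - 2)) = - 4 * count2 0"
    by (simp add: right_diff_distrib sum_subtractf flip: sum_distrib_right)
  have nonneg: "count2 d * (count2 d - 2) \<ge> 0" for d
    using count2_eq_0_or_ge_2[of d] by auto
  then have "(\<Sum>d\<in>UNIV. count2 d * (count2 d - 2)) \<ge> 0"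
    by (intro sum_nonneg) auto
  then show "count2 0 = 0" using * count2_nonneg[of 0] by simp
  then have "(\<Sum>d\<in>UNIV. count2 d * (count2 d - 2)) = 0" using * by simp
  then have "count2 d * (count2 d - 2) = 0"
    using nonneg by (subst (asm) sum_nonneg_eq_0_iff) auto
  then show "count2 d = 0 \<or> count2 d = 2" by auto
qed

lemma count1_pos_iff: "count1 d > 0 \<longleftrightarrow> (\<exists>i a. a \<noteq> 0 \<and> d = col i a)"
  by (auto simp: count1_def card_gt_0_iff units_def col1_def)

lemma count1_0: "count1 0 = 0"
  using count1_pos_iff[of 0] count1_nonneg[of 0] col_nonzero by force

text \<open>The convolution at 0 is the sum of these nonnegative products. Its value is 30 - 30, as
  both counts vanish at 0.\<close>

lemma count1_count2_disjoint: "count1 d * count2 d = 0"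
proof -
  have "(\<Sum>d\<in>UNIV. count1 d * count2 d) = 0"
    using conv_count1_count2[of 0] by (simp add: conv_def count2_0 count1_0)
  then show ?thesis
    by (subst (asm) sum_nonneg_eq_0_iff) (auto simp: count2_nonneg count1_nonneg)
qed

section \<open>Syndromes at distance two\<close>

definition S1 :: "'v set" where
  "S1 = {col i a | i a. a \<noteq> 0}"

definition S2 :: "'v set" where
  "S2 = {d. count2 d = 2}"

text \<open>Identifies \<open>S2\<close>, defined by a multiplicity, with the elements at distance 2
  from 0 in the Cayley graph of \<open>S1\<close>; \<open>count1_count2_disjoint\<close> is what
  keeps \<open>S1\<close> out.\<close>

lemma S2_eq: "d \<in> S2 \<longleftrightarrow> d \<noteq> 0 \<and> d \<notin> S1 \<and> (\<exists>s\<in>S1. \<exists>t\<in>S1. d = s + t)"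
proof
  assume "d \<in> S2"
  then have d: "count2 d = 2" by (simp add: S2_def)
  then have "{r \<in> pairs. col2 r = d} \<noteq> {}"
    unfolding count2_def by (metis card.empty of_nat_0 zero_neq_numeral)
  then have "\<exists>s\<in>S1. \<exists>t\<in>S1. d = s + t"
    by (auto simp: pairs_def units_def col2_def col1_def S1_def)
  moreover have "d \<notin> S1"
    using count1_count2_disjoint[of d] d count1_pos_iff[of d] by (auto simp: S1_def)
  moreover have "d \<noteq> 0" using d count2_0 by auto
  ultimately show "d \<noteq> 0 \<and> d \<notin> S1 \<and> (\<exists>s\<in>S1. \<exists>t\<in>S1. d = s + t)" by blast
next
  assume *: "d \<noteq> 0 \<and> d \<notin> S1 \<and> (\<exists>s\<in>S1. \<exists>t\<in>S1. d = s + t)"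
  then obtain i a j b where ab: "a \<noteq> 0" "b \<noteq> 0" "d = col i a + col j b"
    by (auto simp: S1_def)
  \<comment> \<open>Two syndromes from one coordinate sum to \<open>col i (a + b)\<close>, which is
    0 or lies in \<open>S1\<close>.\<close>
  have "i \<noteq> j"
  proof
    assume "i = j"
    then have "d = col i (a + b)" using ab by (simp add: col_add)
    moreover from this have "a + b = 0" using * by (auto simp: S1_def)
    then have "a = b" by (metis gf4_add_self add.assoc add_0)
    then have "d = 0" using ab \<open>i = j\<close> by (simp add: add_self)
    then show False using * by simp
  qed
  then have "((i, a), (j, b)) \<in> {r \<in> pairs. col2 r = d}"
    using ab by (simp add: pairs_def units_def col2_def col1_def)
  then have "{r \<in> pairs. col2 r = d} \<noteq> {}" by blast
  then have "count2 d \<noteq> 0"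
    unfolding count2_def by (simp only: of_nat_eq_0_iff card_0_eq[OF finite] not_False_eq_True)
  then show "d \<in> S2" using count2_values[of d] by (auto simp: S2_def)
qed

lemma count2_eq: "count2 d = (if d \<in> S2 then 2 else 0)"
  using count2_values[of d] by (auto simp: S2_def)

text \<open>As \<open>count2\<close> is twice the indicator of \<open>S2\<close>, its convolution
  square is 4 times this cardinality.\<close>

lemma card_S2_translate: "int (card {z \<in> S2. z + d \<in> S2})
    = 240 + (if d = 0 then 255 else 0) - (if d \<in> S2 then 2 else 0)"
proof -
  have "conv count2 count2 d = (\<Sum>z\<in>UNIV. if z \<in> {z \<in> S2. z + d \<in> S2} then 4 else 0)"
    unfolding conv_def by (rule sum.cong) (auto simp: count2_eq)
  also have "\<dots> = 4 * int (card {z \<in> S2. z + d \<in> S2})"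
    by (simp add: sum.If_cases)
  finally show ?thesis using conv_count2_count2[of d] by (auto simp: count2_eq)
qed

lemma zero_notin_S2: "0 \<notin> S2"
  using count2_0 by (simp add: S2_def)

lemma card_S2: "card S2 = 495"
  using card_S2_translate[of 0] zero_notin_S2 by simp

end

section \<open>Coset graphs as Cayley graphs\<close>

text \<open>With unit costs a walk costs its length, so distance 2 means a walk of length 2 and none
  of length 0 or 1.\<close>

lemma (in pair_wf_digraph) \<mu>_eq_2_iff:
  assumes "u \<in> pverts G" "v \<in> pverts G"
  shows "\<mu> (\<lambda>_. 1) u v = ereal (real 2) \<longleftrightarrow>
    u \<noteq> v \<and> (u, v) \<notin> parcs G \<and> (\<exists>w. (u, w) \<in> parcs G \<and> (w, v) \<in> parcs G)"
proof -
  have cost: "awalk_cost (\<lambda>_. 1) p = real (length p)" for p :: "('a \<times> 'a) list"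
    by (induction p) (auto simp: awalk_cost_def)
  have len0: "awalk u p v \<and> length p = 0 \<longleftrightarrow> p = [] \<and> u = v" for p
    using assms by (auto simp: awalk_Nil_iff)
  have len1: "awalk u p v \<and> length p = 1 \<longleftrightarrow> p = [(u, v)] \<and> (u, v) \<in> parcs G" for p
    using assms by (cases p) (auto simp: awalk_Nil_iff awalk_Cons_iff)
  have len2: "(\<exists>p. awalk u p v \<and> length p = 2) \<longleftrightarrow> (\<exists>w. (u, w) \<in> parcs G \<and> (w, v) \<in> parcs G)"
  proof
    assume "\<exists>p. awalk u p v \<and> length p = 2"
    then obtain e e' where "awalk u [e, e'] v"
      by (auto simp: length_Suc_conv numeral_2_eq_2)
    then show "\<exists>w. (u, w) \<in> parcs G \<and> (w, v) \<in> parcs G"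
      by (cases e; cases e') (auto simp: awalk_Nil_iff awalk_Cons_iff)
  next
    assume "\<exists>w. (u, w) \<in> parcs G \<and> (w, v) \<in> parcs G"
    then obtain w where "(u, w) \<in> parcs G" "(w, v) \<in> parcs G" by blast
    then have "awalk u [(u, w), (w, v)] v"
      using assms by (auto simp: awalk_Nil_iff awalk_Cons_iff)
    then show "\<exists>p. awalk u p v \<and> length p = 2" by force
  qed
  have "\<mu> (\<lambda>_. 1) u v = ereal (real 2) \<longleftrightarrow>
      (\<exists>p. awalk u p v \<and> length p = 2) \<and> (\<forall>p. awalk u p v \<longrightarrow> length p \<ge> 2)"
  proof
    assume eq: "\<mu> (\<lambda>_. 1) u v = ereal (real 2)"
    have ge: "length p \<ge> 2" if "awalk u p v" for p
      using min_cost_le_walk_cost[OF that, of "\<lambda>_. 1"] unfolding eq cost by simp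
    \<comment> \<open>Avoids asking whether the infimum is attained: a strict upper bound 3 yields
      an actual walk of length at most 2.\<close>
    have "\<mu> (\<lambda>_. 1) u v < ereal 3" unfolding eq by simp
    then obtain p where p: "awalk u p v" "length p < 3"
      unfolding \<mu>_def cost by (auto simp: INF_less_iff)
    then have "length p = 2" using ge[of p] by simp
    with p ge show "(\<exists>p. awalk u p v \<and> length p = 2) \<and> (\<forall>p. awalk u p v \<longrightarrow> length p \<ge> 2)"
      by blast
  next
    assume *: "(\<exists>p. awalk u p v \<and> length p = 2) \<and> (\<forall>p. awalk u p v \<longrightarrow> length p \<ge> 2)"
    then obtain p where p: "awalk u p v" "length p = 2" by blast
    show "\<mu> (\<lambda>_. 1) u v = ereal (real 2)"
    proof (rule antisym)
      show "\<mu> (\<lambda>_. 1) u v \<le> ereal (real 2)"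
        using min_cost_le_walk_cost[OF p(1), of "\<lambda>_. 1"] p(2) by (simp add: cost)
      show "ereal (real 2) \<le> \<mu> (\<lambda>_. 1) u v"
        unfolding \<mu>_def cost using * by (auto intro!: INF_greatest)
    qed
  qed
  also have "(\<forall>p. awalk u p v \<longrightarrow> length p \<ge> 2) \<longleftrightarrow> u \<noteq> v \<and> (u, v) \<notin> parcs G"
  proof -
    have "length p \<ge> 2 \<longleftrightarrow> length p \<noteq> 0 \<and> length p \<noteq> 1" for p :: "('a \<times> 'a) list"
      by linarith
    then show ?thesis using len0 len1 by blast
  qed
  finally show ?thesis using len2 by blast
qed

lemma hamming_weight_eq_1_iff: "hamming_weight x = 1 \<longleftrightarrow> (\<exists>i a. a \<noteq> 0 \<and> x = axis i a)"
proof
  assume "hamming_weight x = 1"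
  then obtain i where i: "{i. x $ i \<noteq> 0} = {i}"
    by (auto simp: hamming_weight_def card_1_singleton_iff)
  then have "x = axis i (x $ i)" by (auto simp: vec_eq_iff axis_def)
  with i show "\<exists>i a. a \<noteq> 0 \<and> x = axis i a" by blast
next
  assume "\<exists>i a. a \<noteq> 0 \<and> x = axis i a"
  then obtain i a where "a \<noteq> 0" "x = axis i a" by blast
  then have "{i. x $ i \<noteq> 0} = {i}" by (auto simp: axis_def)
  then show "hamming_weight x = 1" by (simp add: hamming_weight_def)
qed

lemma axis_add: "axis i (a + b) = axis i a + axis i (b :: gf4)"
  by (simp add: vec_eq_iff axis_def)

text \<open>\<open>h\<close> is an abstract parity-check map: the code is its kernel, and
  surjectivity makes cosets correspond to syndromes.\<close>

locale syndrome_map = bicharacter \<psi>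
  for \<psi> :: "'v :: {finite, ab_group_add} \<Rightarrow> 'v \<Rightarrow> int" +
  fixes h :: "gf4 ^ 'n \<Rightarrow> 'v"
  assumes h_add: "h (x + y) = h x + h y"
    and surj_h: "surj h"
    and h_axis_nonzero: "a \<noteq> 0 \<Longrightarrow> h (axis i a) \<noteq> 0"
    and card_index: "CARD('n) = 11"
    and card_group: "CARD('v) = 1024"
    and eigenvalue:
      "c \<noteq> 0 \<Longrightarrow> (\<Sum>i\<in>UNIV. \<Sum>a\<in>- {0}. \<psi> c (h (axis i a))) \<in> {9, 1, - 7}"
begin

sublocale dual_weights_6_8_10 \<psi> "\<lambda>i a. h (axis i a)"
  by unfold_locales
    (simp_all add: axis_add h_add h_axis_nonzero card_index card_group eigenvalue del: insert_iff)

definition coset :: "'v \<Rightarrow> (gf4 ^ 'n) set" where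
  "coset s = {x. h x = s}"

text \<open>The Cayley graph of the syndrome group carried over to cosets; \<open>s + t\<close> is
  the difference, by exponent 2.\<close>

definition cayley :: "'v set \<Rightarrow> (gf4 ^ 'n) set pair_pre_digraph" where
  "cayley S = \<lparr> pverts = range coset, parcs = {(coset s, coset t) | s t. s + t \<in> S} \<rparr>"

lemma coset_inject [simp]: "coset s = coset t \<longleftrightarrow> s = t"
  using surjD[OF surj_h, of s] by (auto simp: coset_def)

lemma h_diff: "h (x - y) = h x + h y"
  by (metis h_add diff_add_cancel minus_eq_add add_diff_cancel)

lemma translate_kernel: "(+) x ` {y. h y = 0} = coset (h x)"
proof -
  have "z \<in> (+) x ` {y. h y = 0}" if "h z = h x" for z
    using that by (intro image_eqI[of _ _ "z - x"]) (auto simp: h_diff add_self)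
  then show ?thesis by (auto simp: coset_def h_add)
qed

lemma parcs_cayley [simp]: "(coset s, coset t) \<in> parcs (cayley S) \<longleftrightarrow> s + t \<in> S"
  by (auto simp: cayley_def)

lemma pverts_cayley [simp]: "pverts (cayley S) = range coset"
  by (simp add: cayley_def)

lemma zero_notin_S1: "0 \<notin> S1"
  unfolding S1_def using h_axis_nonzero by force

text \<open>Changing one coordinate by \<open>a\<close> shifts the syndrome by
  \<open>h (axis i a)\<close>, an element of \<open>S1\<close>.\<close>

lemma coset_graph_kernel: "coset_graph {x. h x = 0} = cayley S1"
proof -
  have verts: "range (\<lambda>x. (+) x ` {y. h y = 0}) = range coset"
    using surj_h by (simp add: translate_kernel) (metis image_image)
  have adj: "(\<exists>a\<in>coset s. \<exists>b\<in>coset t. hamming_weight (a - b) = 1) \<longleftrightarrow> s + t \<in> S1" for s t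
  proof
    assume "\<exists>a\<in>coset s. \<exists>b\<in>coset t. hamming_weight (a - b) = 1"
    then obtain a b i c where "h a = s" "h b = t" "c \<noteq> 0" "a - b = axis i c"
      unfolding hamming_weight_eq_1_iff coset_def by auto
    then show "s + t \<in> S1"
      unfolding S1_def by (metis (mono_tags, lifting) h_diff mem_Collect_eq)
  next
    assume "s + t \<in> S1"
    then obtain i c where c: "c \<noteq> 0" "s + t = h (axis i c)" by (auto simp: S1_def)
    obtain b where b: "h b = t" using surj_h by (metis surjD)
    have "h (b + axis i c) = s" by (simp add: h_add b flip: c) (simp add: add.left_commute add_self)
    moreover have "hamming_weight (b + axis i c - b) = 1"
      unfolding hamming_weight_eq_1_iff using c by auto
    ultimately show "\<exists>a\<in>coset s. \<exists>b\<in>coset t. hamming_weight (a - b) = 1"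
      using b unfolding coset_def by blast
  qed
  have "{(A, B). A \<in> range coset \<and> B \<in> range coset \<and> A \<noteq> B \<and>
      (\<exists>a\<in>A. \<exists>b\<in>B. hamming_weight (a - b) = 1)} = {(coset s, coset t) | s t. s + t \<in> S1}"
    (is "?L = ?R")
  proof (intro equalityI subsetI)
    fix e assume "e \<in> ?L"
    then obtain s t where "e = (coset s, coset t)"
      "\<exists>a\<in>coset s. \<exists>b\<in>coset t. hamming_weight (a - b) = 1" by blast
    then show "e \<in> ?R" unfolding adj by blast
  next
    fix e assume "e \<in> ?R"
    then obtain s t where e: "e = (coset s, coset t)" "s + t \<in> S1" by blast
    then have "coset s \<noteq> coset t" using zero_notin_S1 by (auto simp: add_self)
    with e adj[of s t] show "e \<in> ?L" by blast
  qed
  then show ?thesis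
    by (simp add: coset_graph_def Let_def verts cayley_def)
qed

lemma pair_wf_digraph_cayley: "pair_wf_digraph (cayley S)"
  by unfold_locales (auto simp: cayley_def)

text \<open>A midpoint \<open>w\<close> corresponds to the decomposition of \<open>s + t\<close>
  into \<open>s + w\<close> and \<open>w + t\<close>, which turns \<open>\<mu>_eq_2_iff\<close> into
  \<open>S2_eq\<close>.\<close>

lemma distance_graph_cayley: "distance_graph 2 (cayley S1) = cayley S2"
proof -
  interpret pair_wf_digraph "cayley S1" by (rule pair_wf_digraph_cayley)
  have "(\<exists>w. (coset s, w) \<in> parcs (cayley S1) \<and> (w, coset t) \<in> parcs (cayley S1)) \<longleftrightarrow>
      (\<exists>w. s + w \<in> S1 \<and> w + t \<in> S1)" for s t
    by (auto simp: cayley_def)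
  moreover have "(\<exists>w. s + w \<in> S1 \<and> w + t \<in> S1) \<longleftrightarrow> (\<exists>a\<in>S1. \<exists>b\<in>S1. s + t = a + b)" for s t
  proof
    assume "\<exists>w. s + w \<in> S1 \<and> w + t \<in> S1"
    then obtain w where w: "s + w \<in> S1" "w + t \<in> S1" by blast
    have "s + t = (s + w) + (w + t)" by (simp add: add.assoc)
    with w show "\<exists>a\<in>S1. \<exists>b\<in>S1. s + t = a + b" by blast
  next
    assume "\<exists>a\<in>S1. \<exists>b\<in>S1. s + t = a + b"
    then obtain a b where ab: "a \<in> S1" "b \<in> S1" "s + t = a + b" by blast
    have "s + (s + a) = a" by simp
    moreover have "(s + a) + t = b"
      using ab(3) by (metis add.commute add.left_commute add_cancel)
    ultimately show "\<exists>w. s + w \<in> S1 \<and> w + t \<in> S1" using ab by metis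
  qed
  ultimately have "\<mu> (\<lambda>_. 1) (coset s) (coset t) = ereal (real 2) \<longleftrightarrow> s + t \<in> S2" for s t
    by (subst \<mu>_eq_2_iff) (auto simp: S2_eq add_eq_0_iff_eq)
  then show ?thesis
    by (auto simp: distance_graph_def cayley_def)
qed

lemma pair_graph_cayley_S2: "pair_graph (cayley S2)"
proof -
  interpret pair_wf_digraph "cayley S2" by (rule pair_wf_digraph_cayley)
  have "parcs (cayley S2) \<subseteq> range coset \<times> range coset"
    by (auto simp: cayley_def)
  then have "finite (parcs (cayley S2))"
    by (rule finite_subset) simp
  moreover have "e \<in> parcs (cayley S2) \<Longrightarrow> fst e \<noteq> snd e" for e
    by (auto simp: cayley_def S2_eq add_self)
  moreover have "symmetric (cayley S2)"
    unfolding symmetric_def sym_def by (auto simp: cayley_def add.commute)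
  ultimately show ?thesis
    by unfold_locales auto
qed

text \<open>The shift by \<open>s\<close> reduces the count to \<open>card_S2_translate\<close> at
  \<open>s + t\<close>.\<close>

lemma common_neighbours_cayley_S2:
  "int (card {z. (coset s, z) \<in> parcs (cayley S2) \<and> (coset t, z) \<in> parcs (cayley S2)})
    = 240 + (if s = t then 255 else 0) - (if s + t \<in> S2 then 2 else 0)"
proof -
  have "{z. (coset s, z) \<in> parcs (cayley S2) \<and> (coset t, z) \<in> parcs (cayley S2)}
      = (\<lambda>z. coset (s + z)) ` {z \<in> S2. z + (s + t) \<in> S2}"
  proof (intro equalityI subsetI)
    fix A assume "A \<in> {z. (coset s, z) \<in> parcs (cayley S2) \<and> (coset t, z) \<in> parcs (cayley S2)}"
    then obtain z where "A = coset z" "s + z \<in> S2" "t + z \<in> S2"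
      by (auto simp: cayley_def)
    then show "A \<in> (\<lambda>z. coset (s + z)) ` {z \<in> S2. z + (s + t) \<in> S2}"
      by (intro image_eqI[of _ _ "s + z"]) (auto simp: add_ac)
  qed (auto simp: add_ac add_self)
  moreover have "inj_on (\<lambda>z. coset (s + z)) B" for B
    by (auto simp: inj_on_def)
  ultimately show ?thesis
    using card_S2_translate[of "s + t"] by (simp add: card_image add_eq_0_iff_eq)
qed

theorem strongly_regular_distance_2:
  "strongly_regular (distance_graph 2 (coset_graph {x. h x = 0})) (2 ^ 10) 495 238 240"
proof -
  have "card (range coset) = 2 ^ 10"
    by (subst card_image) (auto simp: inj_on_def card_group)
  moreover have "out_degree (with_proj (cayley S2)) (coset s) = 495" for s
  proof -
    have "out_arcs (with_proj (cayley S2)) (coset s) = (\<lambda>z. (coset s, coset (s + z))) ` S2"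
    proof (intro equalityI subsetI)
      fix e assume "e \<in> out_arcs (with_proj (cayley S2)) (coset s)"
      then obtain t where "e = (coset s, coset t)" "s + t \<in> S2"
        by (auto simp: cayley_def)
      then show "e \<in> (\<lambda>z. (coset s, coset (s + z))) ` S2"
        by (intro image_eqI[of _ _ "s + t"]) auto
    qed auto
    then show ?thesis
      by (simp add: out_degree_def card_image inj_on_def card_S2)
  qed
  \<comment> \<open>Adjacency forces \<open>s \<noteq> t\<close>, since 0 is not in
    \<open>S2\<close>, and the count is 240 - 2; distinct non-adjacent vertices keep 240.\<close>
  ultimately show ?thesis
    unfolding strongly_regular_def coset_graph_kernel distance_graph_cayley
    using pair_graph_cayley_S2
    by (auto simp: add_self zero_notin_S2 common_neighbours_cayley_S2
        intro!: int_int_eq[THEN iffD1])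
qed

end

section \<open>The syndrome map of the code\<close>

lemma exhaust_11:
  fixes i :: 11
  shows "i = 1 \<or> i = 2 \<or> i = 3 \<or> i = 4 \<or> i = 5 \<or> i = 6 \<or> i = 7 \<or> i = 8
      \<or> i = 9 \<or> i = 10 \<or> i = 11"
proof (induct i)
  case (of_int z)
  \<comment> \<open>In the numeral type 11 equals 0, so the residue 0 is the last index.\<close>
  then have "z = 0 \<or> z = 1 \<or> z = 2 \<or> z = 3 \<or> z = 4 \<or> z = 5 \<or> z = 6
      \<or> z = 7 \<or> z = 8 \<or> z = 9 \<or> z = 10"
    by simp presburger
  then show ?case by auto
qed

lemma forall_11: "(\<forall>i :: 11. P i) \<longleftrightarrow>
    P 1 \<and> P 2 \<and> P 3 \<and> P 4 \<and> P 5 \<and> P 6 \<and> P 7 \<and> P 8 \<and> P 9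
        \<and> P 10 \<and> P 11"
  by (metis exhaust_11)

lemma UNIV_11: "UNIV = {1, 2, 3, 4, 5, 6, 7, 8, 9, 10, 11 :: 11}"
  using exhaust_11 by auto

lemma sum_11: "sum f (UNIV :: 11 set) =
    f 1 + f 2 + f 3 + f 4 + f 5 + f 6 + f 7 + f 8 + f 9 + f 10 + f 11"
  unfolding UNIV_11 by (simp add: add.assoc)

lemma vector_11:
  fixes x1 x2 x3 x4 x5 x6 x7 x8 x9 x10 x11 :: "'a :: zero"
  defines "v \<equiv> vector [x1, x2, x3, x4, x5, x6, x7, x8, x9, x10, x11] :: 'a ^ 11"
  shows "v $ 1 = x1" "v $ 2 = x2" "v $ 3 = x3" "v $ 4 = x4" "v $ 5 = x5" "v $ 6 = x6"
    "v $ 7 = x7" "v $ 8 = x8" "v $ 9 = x9" "v $ 10 = x10" "v $ 11 = x11"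
  unfolding v_def vector_def by simp_all

text \<open>This is -1 to the power Tr(x y^2), the trace Hermitian form, which vanishes exactly if
  an argument is 0 or both agree.\<close>

fun gf4_character :: "gf4 \<Rightarrow> gf4 \<Rightarrow> int" where
  "gf4_character x y = (if x = 0 \<or> y = 0 \<or> x = y then 1 else - 1)"

lemma bicharacter_gf4_character: "bicharacter gf4_character"
proof
  fix c x y :: gf4
  show "gf4_character c (x + y) = gf4_character c x * gf4_character c y"
    by (cases c; cases x; cases y) (simp_all add: zero_gf4_def)
  show "gf4_character c x = gf4_character x c" by auto
  show "gf4_character c 0 = 1" by simp
  show "(\<Sum>c\<in>UNIV. gf4_character c x) = (if x = 0 then int CARD(gf4) else 0)"
    by (cases x) (simp_all add: UNIV_gf4 power2_eq_square zero_gf4_def one_gf4_def)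
  show "x + x = 0" by (rule gf4_add_self)
qed

type_synonym syndrome = "gf4 \<times> gf4 \<times> gf4 \<times> gf4 \<times> gf4"

definition syndrome_character :: "syndrome \<Rightarrow> syndrome \<Rightarrow> int" where
  "syndrome_character = (\<lambda>(c1, c2, c3, c4, c5) (x1, x2, x3, x4, x5).
     gf4_character c1 x1 * (gf4_character c2 x2 * (gf4_character c3 x3 * (gf4_character c4 x4 * gf4_character c5 x5))))"

lemma bicharacter_syndrome_character: "bicharacter syndrome_character"
proof -
  have "syndrome_character = (\<lambda>c x. gf4_character (fst c) (fst x) * (gf4_character (fst (snd c)) (fst (snd x)) *
      (gf4_character (fst (snd (snd c))) (fst (snd (snd x))) *
      (gf4_character (fst (snd (snd (snd c)))) (fst (snd (snd (snd x)))) *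
       gf4_character (snd (snd (snd (snd c)))) (snd (snd (snd (snd x))))))))"
    by (auto simp: syndrome_character_def fun_eq_iff simp del: gf4_character.simps)
  then show ?thesis
    using bicharacter_prod[OF bicharacter_gf4_character bicharacter_prod[OF
      bicharacter_gf4_character bicharacter_prod[OF
      bicharacter_gf4_character bicharacter_prod[OF bicharacter_gf4_character bicharacter_gf4_character]]]]
    by (simp only:)
qed

text \<open>Checks of an additive code are only F2-linear in each coordinate; such a map is fixed by
  the images \<open>p\<close> of 1 and \<open>q\<close> of \<open>\<omega>\<close>.\<close>

fun f2_linear :: "gf4 \<Rightarrow> gf4 \<Rightarrow> gf4 \<Rightarrow> gf4" where
  "f2_linear p q GF4_0 = 0"
| "f2_linear p q GF4_1 = p"
| "f2_linear p q GF4_omega = q"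
| "f2_linear p q GF4_omega_sq = p + q"

lemma f2_linear_add: "f2_linear p q (a + b) = f2_linear p q a + f2_linear p q b"
  by (cases a; cases b; cases p; cases q) (simp_all add: zero_gf4_def)

lemma f2_linear_0 [simp]: "f2_linear p q 0 = 0"
  by (simp add: zero_gf4_def)

lemma f2_linear_1 [simp]: "f2_linear p q 1 = p"
  by (simp add: one_gf4_def)

lemma f2_linear_omega_sq [simp]: "f2_linear p q (\<omega>\<^sup>2) = p + q"
  by (simp add: power2_eq_square)

text \<open>The coefficients come from the generator matrix of \<open>D\<^sup>-\<close> that is systematic in the first
  six coordinates: the images of \<open>1\<close> and \<open>\<omega>\<close> in coordinate \<open>i\<close> are the tails of its rows.\<close>

definition h_minus :: "gf4 ^ 11 \<Rightarrow> syndrome" where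
  "h_minus x =
    (x $ 7 + f2_linear (\<omega>\<^sup>2) \<omega> (x $ 1) + f2_linear 1 \<omega> (x $ 2) + f2_linear \<omega> 1 (x $ 3)
       + f2_linear \<omega> \<omega> (x $ 4) + f2_linear 0 1 (x $ 5) + f2_linear (\<omega>\<^sup>2) 0 (x $ 6),
     x $ 8 + f2_linear (\<omega>\<^sup>2) 1 (x $ 1) + f2_linear 1 (\<omega>\<^sup>2) (x $ 2) + f2_linear (\<omega>\<^sup>2) 0 (x $ 3)
       + f2_linear 0 1 (x $ 4) + f2_linear (\<omega>\<^sup>2) \<omega> (x $ 5) + f2_linear \<omega> \<omega> (x $ 6),
     x $ 9 + f2_linear (\<omega>\<^sup>2) \<omega> (x $ 1) + f2_linear 1 0 (x $ 2) + f2_linear (\<omega>\<^sup>2) 1 (x $ 3)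
       + f2_linear \<omega> 1 (x $ 4) + f2_linear (\<omega>\<^sup>2) (\<omega>\<^sup>2) (x $ 5) + f2_linear 0 \<omega> (x $ 6),
     x $ 10 + f2_linear 0 \<omega> (x $ 1) + f2_linear (\<omega>\<^sup>2) (\<omega>\<^sup>2) (x $ 2) + f2_linear \<omega> 1 (x $ 3)
       + f2_linear (\<omega>\<^sup>2) 1 (x $ 4) + f2_linear 1 0 (x $ 5) + f2_linear (\<omega>\<^sup>2) \<omega> (x $ 6),
     x $ 11 + f2_linear \<omega> \<omega> (x $ 1) + f2_linear (\<omega>\<^sup>2) \<omega> (x $ 2) + f2_linear 0 1 (x $ 3)
       + f2_linear (\<omega>\<^sup>2) 0 (x $ 4) + f2_linear 1 (\<omega>\<^sup>2) (x $ 5) + f2_linear (\<omega>\<^sup>2) 1 (x $ 6))"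

lemma h_minus_add: "h_minus (x + y) = h_minus x + h_minus y"
  by (simp add: h_minus_def f2_linear_add ac_simps)

lemma h_minus_scale: "h_minus (scaleF2 c x) = (if c = 0 then 0 else h_minus x)"
  by (auto simp: scaleF2_def gf4_of_bit_def h_minus_def zero_prod_def)

lemma surj_h_minus: "surj h_minus"
proof (rule surjI)
  fix s :: syndrome
  show "h_minus (case s of (s1, s2, s3, s4, s5) \<Rightarrow> vector [0, 0, 0, 0, 0, 0, s1, s2, s3, s4, s5]) = s"
    by (cases s) (simp add: h_minus_def vector_11)
qed

lemma gf4_add_eq_0_iff: "a + b = 0 \<longleftrightarrow> a = (b :: gf4)"
  by (cases a; cases b) (simp_all add: zero_gf4_def)

lemmas gf4_constructors = zero_gf4_def one_gf4_def power2_eq_square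

lemma gf4_sums:
  "\<omega> + \<omega> = 0" "\<omega>\<^sup>2 + \<omega>\<^sup>2 = 0"
  "\<omega> + 1 = \<omega>\<^sup>2" "\<omega>\<^sup>2 + 1 = \<omega>" "\<omega>\<^sup>2 + \<omega> = 1"
  "1 + \<omega> = \<omega>\<^sup>2" "1 + \<omega>\<^sup>2 = \<omega>" "\<omega> + \<omega>\<^sup>2 = 1"
  by (simp_all add: gf4_constructors)

section \<open>The kernel of the syndrome map is the code\<close>

lemma D_minus_le_kernel: "D_minus \<subseteq> {x. h_minus x = 0}"
  unfolding D_minus_def
proof (rule F2.span_minimal)
  show "F2.subspace {x. h_minus x = 0}"
    by (auto simp: F2.subspace_def h_minus_add h_minus_scale) (simp add: h_minus_def zero_prod_def)
qed (simp add: h_minus_def vector_11 zero_prod_def gf4_constructors)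

fun f2_linear_vec :: "gf4 ^ 'n \<Rightarrow> gf4 ^ 'n \<Rightarrow> gf4 \<Rightarrow> gf4 ^ 'n" where
  "f2_linear_vec u v GF4_0 = 0"
| "f2_linear_vec u v GF4_1 = u"
| "f2_linear_vec u v GF4_omega = v"
| "f2_linear_vec u v GF4_omega_sq = u + v"

lemma f2_linear_vec_nth: "f2_linear_vec u v a $ k = f2_linear (u $ k) (v $ k) a"
  by (cases a) simp_all

lemma f2_linear_vec_in_D_minus: "u \<in> D_minus \<Longrightarrow> v \<in> D_minus \<Longrightarrow>
    f2_linear_vec u v a \<in> D_minus"
  unfolding D_minus_def by (cases a) (simp_all add: F2.span_zero F2.span_add)

lemma f2_linear_0_0: "f2_linear 0 0 a = 0"
  by (cases a) simp_all

lemma f2_linear_1_omega: "f2_linear 1 \<omega> a = a"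
  by (cases a) (simp_all add: zero_gf4_def one_gf4_def)

text \<open>A kernel vector is determined by its first six entries, and systematic rows combine to a
  codeword with any prescribed entries there.\<close>

lemma kernel_le_D_minus: "{x. h_minus x = 0} \<subseteq> D_minus"
proof
  fix x assume "x \<in> {x. h_minus x = 0}"
  then have x: "h_minus x = 0" by simp
  have generators:
    "vector [0, 0, 0, 0, 0, \<omega>\<^sup>2, \<omega>\<^sup>2, 0, \<omega>, 1, \<omega>] \<in> D_minus"
    "vector [0, 0, 0, 0, 0, \<omega>, 0, \<omega>, \<omega>, \<omega>, 1] \<in> D_minus"
    "vector [1, 0, 0, 0, 0, 1, 0, 1, \<omega>\<^sup>2, \<omega>\<^sup>2, 1] \<in> D_minus"
    "vector [\<omega>, 0, 0, 0, 0, 0, \<omega>, 1, \<omega>, \<omega>, \<omega>] \<in> D_minus"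
    "vector [0, 1, 0, 0, 0, 0, 1, 1, 1, \<omega>\<^sup>2, \<omega>\<^sup>2] \<in> D_minus"
    "vector [0, \<omega>, 0, 0, 0, \<omega>\<^sup>2, 1, \<omega>\<^sup>2, \<omega>, \<omega>, 0] \<in> D_minus"
    "vector [0, 0, 1, 0, 0, \<omega>, \<omega>, 1, 1, 0, 1] \<in> D_minus"
    "vector [0, 0, \<omega>, 0, 0, \<omega>, 1, \<omega>, \<omega>\<^sup>2, \<omega>\<^sup>2, 0] \<in> D_minus"
    "vector [0, 0, 0, 1, 0, \<omega>, \<omega>, \<omega>, 0, 1, \<omega>] \<in> D_minus"
    "vector [0, 0, 0, \<omega>, 0, \<omega>\<^sup>2, 1, 1, \<omega>\<^sup>2, 0, \<omega>] \<in> D_minus"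
    "vector [0, 0, 0, 0, 1, \<omega>\<^sup>2, \<omega>\<^sup>2, \<omega>\<^sup>2, 1, 0, \<omega>\<^sup>2] \<in> D_minus"
    "vector [0, 0, 0, 0, \<omega>, \<omega>, 1, 0, 1, \<omega>, \<omega>] \<in> D_minus"
    unfolding D_minus_def by (rule F2.span_base; blast)+
  have add_D_minus: "u + v \<in> D_minus" if "u \<in> D_minus" "v \<in> D_minus" for u v
    using that unfolding D_minus_def by (rule F2.span_add)
  \<comment> \<open>The systematic rows arise by clearing coordinate 6 with the first two
    generators, which vanish on coordinates 1 to 5.\<close>
  define r1 :: "gf4 ^ 11" where "r1 = vector [1, 0, 0, 0, 0, 0, \<omega>\<^sup>2, \<omega>\<^sup>2, \<omega>\<^sup>2, 0, \<omega>]"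
  define r2 :: "gf4 ^ 11" where "r2 = vector [\<omega>, 0, 0, 0, 0, 0, \<omega>, 1, \<omega>, \<omega>, \<omega>]"
  define r3 :: "gf4 ^ 11" where "r3 = vector [0, 1, 0, 0, 0, 0, 1, 1, 1, \<omega>\<^sup>2, \<omega>\<^sup>2]"
  define r4 :: "gf4 ^ 11" where "r4 = vector [0, \<omega>, 0, 0, 0, 0, \<omega>, \<omega>\<^sup>2, 0, \<omega>\<^sup>2, \<omega>]"
  define r5 :: "gf4 ^ 11" where "r5 = vector [0, 0, 1, 0, 0, 0, \<omega>, \<omega>\<^sup>2, \<omega>\<^sup>2, \<omega>, 0]"
  define r6 :: "gf4 ^ 11" where "r6 = vector [0, 0, \<omega>, 0, 0, 0, 1, 0, 1, 1, 1]"
  define r7 :: "gf4 ^ 11" where "r7 = vector [0, 0, 0, 1, 0, 0, \<omega>, 0, \<omega>, \<omega>\<^sup>2, \<omega>\<^sup>2]"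
  define r8 :: "gf4 ^ 11" where "r8 = vector [0, 0, 0, \<omega>, 0, 0, \<omega>, 1, 1, 1, 0]"
  define r9 :: "gf4 ^ 11" where "r9 = vector [0, 0, 0, 0, 1, 0, 0, \<omega>\<^sup>2, \<omega>\<^sup>2, 1, 1]"
  define r10 :: "gf4 ^ 11" where "r10 = vector [0, 0, 0, 0, \<omega>, 0, 1, \<omega>, \<omega>\<^sup>2, 0, \<omega>\<^sup>2]"
  define r11 :: "gf4 ^ 11" where "r11 = vector [0, 0, 0, 0, 0, 1, \<omega>\<^sup>2, \<omega>, 0, \<omega>\<^sup>2, \<omega>\<^sup>2]"
  define r12 :: "gf4 ^ 11" where "r12 = vector [0, 0, 0, 0, 0, \<omega>, 0, \<omega>, \<omega>, \<omega>, 1]"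
  have "r1 =
      vector [0, 0, 0, 0, 0, \<omega>\<^sup>2, \<omega>\<^sup>2, 0, \<omega>, 1, \<omega>]
      + vector [0, 0, 0, 0, 0, \<omega>, 0, \<omega>, \<omega>, \<omega>, 1]
      + vector [1, 0, 0, 0, 0, 1, 0, 1, \<omega>\<^sup>2, \<omega>\<^sup>2, 1]"
    by (simp add: r1_def vec_eq_iff forall_11 vector_11 gf4_constructors)
  then have m1: "r1 \<in> D_minus"
    by (simp only:) (intro add_D_minus generators)
  have m2: "r2 \<in> D_minus"
    unfolding r2_def by (rule generators)
  have m3: "r3 \<in> D_minus"
    unfolding r3_def by (rule generators)
  have "r4 =
      vector [0, 0, 0, 0, 0, \<omega>\<^sup>2, \<omega>\<^sup>2, 0, \<omega>, 1, \<omega>]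
      + vector [0, \<omega>, 0, 0, 0, \<omega>\<^sup>2, 1, \<omega>\<^sup>2, \<omega>, \<omega>, 0]"
    by (simp add: r4_def vec_eq_iff forall_11 vector_11 gf4_constructors)
  then have m4: "r4 \<in> D_minus"
    by (simp only:) (intro add_D_minus generators)
  have "r5 =
      vector [0, 0, 0, 0, 0, \<omega>, 0, \<omega>, \<omega>, \<omega>, 1]
      + vector [0, 0, 1, 0, 0, \<omega>, \<omega>, 1, 1, 0, 1]"
    by (simp add: r5_def vec_eq_iff forall_11 vector_11 gf4_constructors)
  then have m5: "r5 \<in> D_minus"
    by (simp only:) (intro add_D_minus generators)
  have "r6 =
      vector [0, 0, 0, 0, 0, \<omega>, 0, \<omega>, \<omega>, \<omega>, 1]
      + vector [0, 0, \<omega>, 0, 0, \<omega>, 1, \<omega>, \<omega>\<^sup>2, \<omega>\<^sup>2, 0]"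
    by (simp add: r6_def vec_eq_iff forall_11 vector_11 gf4_constructors)
  then have m6: "r6 \<in> D_minus"
    by (simp only:) (intro add_D_minus generators)
  have "r7 =
      vector [0, 0, 0, 0, 0, \<omega>, 0, \<omega>, \<omega>, \<omega>, 1]
      + vector [0, 0, 0, 1, 0, \<omega>, \<omega>, \<omega>, 0, 1, \<omega>]"
    by (simp add: r7_def vec_eq_iff forall_11 vector_11 gf4_constructors)
  then have m7: "r7 \<in> D_minus"
    by (simp only:) (intro add_D_minus generators)
  have "r8 =
      vector [0, 0, 0, 0, 0, \<omega>\<^sup>2, \<omega>\<^sup>2, 0, \<omega>, 1, \<omega>]
      + vector [0, 0, 0, \<omega>, 0, \<omega>\<^sup>2, 1, 1, \<omega>\<^sup>2, 0, \<omega>]"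
    by (simp add: r8_def vec_eq_iff forall_11 vector_11 gf4_constructors)
  then have m8: "r8 \<in> D_minus"
    by (simp only:) (intro add_D_minus generators)
  have "r9 =
      vector [0, 0, 0, 0, 0, \<omega>\<^sup>2, \<omega>\<^sup>2, 0, \<omega>, 1, \<omega>]
      + vector [0, 0, 0, 0, 1, \<omega>\<^sup>2, \<omega>\<^sup>2, \<omega>\<^sup>2, 1, 0, \<omega>\<^sup>2]"
    by (simp add: r9_def vec_eq_iff forall_11 vector_11 gf4_constructors)
  then have m9: "r9 \<in> D_minus"
    by (simp only:) (intro add_D_minus generators)
  have "r10 =
      vector [0, 0, 0, 0, 0, \<omega>, 0, \<omega>, \<omega>, \<omega>, 1]
      + vector [0, 0, 0, 0, \<omega>, \<omega>, 1, 0, 1, \<omega>, \<omega>]"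
    by (simp add: r10_def vec_eq_iff forall_11 vector_11 gf4_constructors)
  then have m10: "r10 \<in> D_minus"
    by (simp only:) (intro add_D_minus generators)
  have "r11 =
      vector [0, 0, 0, 0, 0, \<omega>\<^sup>2, \<omega>\<^sup>2, 0, \<omega>, 1, \<omega>]
      + vector [0, 0, 0, 0, 0, \<omega>, 0, \<omega>, \<omega>, \<omega>, 1]"
    by (simp add: r11_def vec_eq_iff forall_11 vector_11 gf4_constructors)
  then have m11: "r11 \<in> D_minus"
    by (simp only:) (intro add_D_minus generators)
  have m12: "r12 \<in> D_minus"
    unfolding r12_def by (rule generators)
  \<comment> \<open>In the first six coordinates this is \<open>f2_linear_1_omega\<close>; in the
    last five it is the vanishing of the syndrome.\<close>
  have "x = f2_linear_vec r1 r2 (x $ 1) + f2_linear_vec r3 r4 (x $ 2) + f2_linear_vec r5 r6 (x $ 3)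
      + f2_linear_vec r7 r8 (x $ 4) + f2_linear_vec r9 r10 (x $ 5) + f2_linear_vec r11 r12 (x $ 6)"
    using x by (simp add: h_minus_def vec_eq_iff forall_11 f2_linear_vec_nth vector_11 zero_prod_def
      gf4_add_eq_0_iff f2_linear_0_0 f2_linear_1_omega r1_def r2_def r3_def r4_def r5_def r6_def
          r7_def r8_def r9_def r10_def r11_def r12_def add.assoc)
  also have "\<dots> \<in> D_minus"
    by (intro add_D_minus f2_linear_vec_in_D_minus m1 m2 m3 m4 m5 m6 m7 m8 m9 m10 m11 m12)
  finally show "x \<in> D_minus" .
qed

text \<open>The eigenvalue at the character \<open>c\<close>, written in the signs \<open>u\<^sub>k\<close>, \<open>v\<^sub>k\<close> that the \<open>k\<close>-th
  entry of \<open>c\<close> assigns to \<open>1\<close> and \<open>\<omega>\<close>; each bracket comes from one of the eleven coordinates.\<close>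

lemma sign_polynomial:
  fixes u1 u2 u3 u4 u5 v1 v2 v3 v4 v5 :: int
  assumes "u1 = 1 \<or> u1 = - 1" "u2 = 1 \<or> u2 = - 1" "u3 = 1 \<or> u3 = - 1"
      "u4 = 1 \<or> u4 = - 1" "u5 = 1 \<or> u5 = - 1"
    and "v1 = 1 \<or> v1 = - 1" "v2 = 1 \<or> v2 = - 1" "v3 = 1 \<or> v3 = - 1"
      "v4 = 1 \<or> v4 = - 1" "v5 = 1 \<or> v5 = - 1"
    and "\<not> (u1 = 1 \<and> u2 = 1 \<and> u3 = 1 \<and> u4 = 1 \<and> u5 = 1 \<and>
      v1 = 1 \<and> v2 = 1 \<and> v3 = 1 \<and> v4 = 1 \<and> v5 = 1)"
  shows "(u1 * v1 * u2 * v2 * u3 * v3 * v5 + v1 * u2 * v3 * v4 * v5 + u1 * v2 * u3 * v4)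
      + (u1 * u2 * u3 * u4 * v4 * u5 * v5 + v1 * u2 * v2 * u4 * v4 * v5 + u1 * v1 * v2 * u3 * u5)
      + (v1 * u2 * v2 * u3 * v3 * v4 + u1 * u3 * u4 * u5 + u1 * v1 * u2 * v2 * v3 * u4 * v4 * u5)
      + (v1 * v3 * u4 * v4 * u5 * v5 + v1 * u2 * u3 * u4 + u2 * u3 * v3 * v4 * u5 * v5)
      + (u2 * v2 * u3 * v3 * u4 * u5 + u1 * v2 * u3 * v3 * u5 * v5 + u1 * u2 * u4 * v5)
      + (u1 * v1 * v2 * u4 * v4 * u5 * v5 + v2 * v3 * v4 * u5 + u1 * v1 * v3 * u4 * v5)
      + (u1 + v1 + u1 * v1)
      + (u2 + v2 + u2 * v2)
      + (u3 + v3 + u3 * v3)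
      + (u4 + v4 + u4 * v4)
      + (u5 + v5 + u5 * v5)
      \<in> {9, 1, - 7}"
  \<comment> \<open>Exhausts the 2^10 sign patterns; the all-ones pattern, with value 33,
    contradicts the last assumption.\<close>
  using assms by (elim disjE; hypsubst; simp)

lemma gf4_character_omega_sq: "gf4_character c (\<omega>\<^sup>2) = gf4_character c 1 * gf4_character c \<omega>"
  by (cases c) (simp_all add: zero_gf4_def one_gf4_def power2_eq_square)

lemma gf4_character_sign: "gf4_character c x = 1 \<or> gf4_character c x = - 1"
  by simp

lemma gf4_character_trivial: "gf4_character c 1 = 1 \<Longrightarrow> gf4_character c \<omega> = 1 \<Longrightarrow> c = 0"
  by (cases c) (simp_all add: zero_gf4_def one_gf4_def split: if_splits)

lemma gf4_character_0: "gf4_character c 0 = 1"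
  by simp

text \<open>The sign at \<open>\<omega>\<^sup>2\<close> is the product of those at 1 and
  \<open>\<omega>\<close>, so every summand is a monomial in the signs and the sum is that of
  \<open>sign_polynomial\<close>.\<close>

lemma eigenvalue_h_minus:
  assumes "c \<noteq> 0"
  shows "(\<Sum>i\<in>UNIV. \<Sum>a\<in>- {0}. syndrome_character c (h_minus (axis i a))) \<in> {9, 1, - 7}"
proof -
  obtain c1 c2 c3 c4 c5 where c: "c = (c1, c2, c3, c4, c5)"
    by (cases c) auto
  have nontrivial: "\<not> (gf4_character c1 1 = 1 \<and> gf4_character c2 1 = 1 \<and>
      gf4_character c3 1 = 1 \<and> gf4_character c4 1 = 1 \<and> gf4_character c5 1 = 1 \<and>
      gf4_character c1 \<omega> = 1 \<and> gf4_character c2 \<omega> = 1 \<and>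
      gf4_character c3 \<omega> = 1 \<and> gf4_character c4 \<omega> = 1 \<and> gf4_character c5 \<omega> = 1)"
    using assms gf4_character_trivial unfolding c zero_prod_def by blast
  have line: "(\<Sum>a\<in>- {0}. syndrome_character c (h_minus (axis i a))) =
      syndrome_character c (h_minus (axis i 1)) + syndrome_character c (h_minus (axis i \<omega>))
      + syndrome_character c (h_minus (axis i (\<omega>\<^sup>2)))" for i
    by (simp add: gf4_nonzero omega_squared)
  show ?thesis
    using sign_polynomial[OF gf4_character_sign gf4_character_sign gf4_character_sign
      gf4_character_sign gf4_character_sign gf4_character_sign gf4_character_sign
      gf4_character_sign gf4_character_sign gf4_character_sign nontrivial]
    unfolding line sum_11
    \<comment> \<open>The deleted rules keep the signs opaque and the three-element set folded, so
      that both sides match.\<close>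
    by (simp add: h_minus_def axis_def c syndrome_character_def gf4_character_0
        gf4_character_omega_sq gf4_sums mult.assoc
        del: gf4_character.simps insert_iff plus_gf4.simps)
qed

text \<open>Amounts to the code having no word of weight 1.\<close>

lemma h_minus_axis_nonzero: "a \<noteq> 0 \<Longrightarrow> h_minus (axis i a) \<noteq> 0"
proof -
  assume "a \<noteq> 0"
  then have "\<forall>i. h_minus (axis i a) \<noteq> 0"
    unfolding forall_11 h_minus_def zero_prod_def
    by (cases a) (simp_all add: axis_def gf4_constructors)
  then show ?thesis by blast
qed

theorem theorem10:
  shows "strongly_regular (distance_graph 2 (coset_graph D_minus)) (2 ^ 10) 495 238 240"
proof -
  interpret bicharacter syndrome_character by (rule bicharacter_syndrome_character)
  \<comment> \<open>Gives the order 4^5 = 1024 of the syndrome group.\<close>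
  have "CARD(gf4) = 4"
    by (simp add: UNIV_gf4 omega_squared)
  then interpret syndrome_map syndrome_character h_minus
    by unfold_locales (simp_all add: h_minus_add surj_h_minus h_minus_axis_nonzero eigenvalue_h_minus
        del: insert_iff)
  show ?thesis
    using strongly_regular_distance_2 D_minus_le_kernel kernel_le_D_minus by (metis subset_antisym)
qed

end
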